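(* Let $\mathsf{x}^*=\sum_{j\in\mathcal{J}}x_j^*\mathbf{e}_j\in\mathbb{R}^n$, where $\mathcal{J}=\mathrm{supp}(\mathsf{x}^* )$, let $\mathcal{J}^c=\{1,\dots,n\}\setminus\mathcal{J}$, and let $\tilde{j}\in\mathcal{J}$. Assume that $$\mathsf{A}\mathbf{e}_i\neq\eta\,\mathsf{A}\mathbf{e}_j\quad\forall i,j\in\{1,\dots,n\},\ i\neq j,\ \forall\eta\in\mathbb{R}.$$ If $\mathbf{e}_j\in\mathcal{N}(\mathsf{A})^\perp$ for all $j\in\mathcal{J}\setminus\{\tilde{j}\}$, then there exist real numbers $(a_j)_{j\in\mathcal{J}}$ such that $$\Big[\sum_{j\in\mathcal{J}}a_j\mathsf{W}^{-1}\mathsf{P}\mathbf{e}_j\Big]_i=\mathrm{sgn}(x_i^* )\quad\forall i\in\mathcal{J},\qquad \Big[\sum_{j\in\mathcal{J}}a_j\mathsf{W}^{-1}\mathsf{P}\mathbf{e}_j\Big]_i\in(-1,1)\quad\forall i\in\mathcal{J}^c,$$ and, with these $a_j$, the vector $$\mathbf{y}_\alpha^*=\sum_{j\in\mathcal{J}}(x_j^*-\alpha a_j)\mathbf{e}_j$$ solves $$\min_{\mathbf{x}\in\mathbb{R}^n}\left\{\frac12\|\mathsf{P}\mathbf{x}-\mathsf{P}\mathsf{x}^*\|_2^2+\alpha\|\mathsf{W}\mathbf{x}\|_1\right\},$$ provided that $\alpha>0$ is chosen such that $\mathrm{sgn}(x_j^*-\alpha a_j)=\mathrm{sgn}(x_j^*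 )$ for all $j\in\mathcal{J}$.
   Context: $\mathsf{A}\in\mathbb{R}^{m\times n}$ is a matrix with nontrivial null space $\mathcal{N}(\mathsf{A})$, $\mathsf{A}^\dagger$ is its Moore-Penrose pseudo-inverse, and $\mathsf{P}=\mathsf{A}^\dagger\mathsf{A}$ is the orthogonal projection of $\mathbb{R}^n$ onto $\mathcal{N}(\mathsf{A})^\perp$. $\mathbf{e}_1,\dots,\mathbf{e}_n$ are the standard basis vectors of $\mathbb{R}^n$, and it is assumed that $\mathsf{P}\mathbf{e}_i\neq 0$ for all $i$. $\mathsf{W}\in\mathbb{R}^{n\times n}$ is the (invertible) diagonal matrix defined by $\mathsf{W}\mathbf{e}_i=\|\mathsf{P}\mathbf{e}_i\|_2\,\mathbf{e}_i$. $[\mathbf{v}]_i$ is the $i$-th component of $\mathbf{v}$; $\mathrm{supp}(\mathbf{v})=\{i: v_i\neq 0\}$. *)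

theory Defs
  imports "HOL-Analysis.Analysis"
begin

definition null_space :: "real^'n^'m \<Rightarrow> (real^'n) set" where
  "null_space A = {x. A *v x = 0}"

text \<open>The Moore--Penrose pseudo-inverse, characterised by the four Penrose equations;
  the lemma \<open>ex1_penrose_inverse\<close> below shows that it is well defined.\<close>

definition is_penrose_inverse :: "real^'n^'m \<Rightarrow> real^'m^'n \<Rightarrow> bool" where
  "is_penrose_inverse A X \<longleftrightarrow>
     A ** X ** A = A \<and> X ** A ** X = X \<and>
     transpose (A ** X) = A ** X \<and> transpose (X ** A) = X ** A"

definition pinv :: "real^'n^'m \<Rightarrow> real^'m^'n" where
  "pinv A = (THE X. is_penrose_inverse A X)"

definition P_mat :: "real^'n^'m \<Rightarrow> real^'n^'n" where
  "P_mat A = pinv A ** A"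

definition W_mat :: "real^'n^'m \<Rightarrow> real^'n^'n" where
  "W_mat A = (\<chi> i j. if i = j then norm (P_mat A *v axis i 1) else 0)"

definition supp :: "real^'n \<Rightarrow> 'n set" where
  "supp v = {i. v $ i \<noteq> 0}"

text \<open>The Euclidean norm is the library's \<^const>\<open>norm\<close> on \<^typ>\<open>real^'n\<close>.\<close>

definition l1_norm :: "real^'n \<Rightarrow> real" where
  "l1_norm v = (\<Sum>i\<in>UNIV. \<bar>v $ i\<bar>)"

lemma W_mat_axis: "W_mat A *v axis i 1 = norm (P_mat A *v axis i 1) *\<^sub>R axis i 1"
  unfolding matrix_vector_mult_basis[of "W_mat A"]
  by (auto simp: W_mat_def vec_eq_iff column_def) (auto simp: axis_def)

lemma penrose_inverse_unique:
  assumes "is_penrose_inverse A X" "is_penrose_inverse A Y"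
  shows "X = Y"
proof -
  note X = assms(1)[unfolded is_penrose_inverse_def]
  note Y = assms(2)[unfolded is_penrose_inverse_def]
  have "(A ** X) = transpose (A ** X)" using X by simp
  also have "\<dots> = transpose ((A ** Y) ** (A ** X))"
    using Y by (simp add: matrix_mul_assoc)
  also have "\<dots> = (A ** X) ** (A ** Y)"
    using X Y by (simp add: matrix_transpose_mul[of "A ** Y" "A ** X"])
  also have "\<dots> = A ** Y" using X by (simp add: matrix_mul_assoc)
  finally have AXY: "A ** X = A ** Y" .
  have "(X ** A) = transpose (X ** A)" using X by simp
  also have "\<dots> = transpose ((X ** A) ** (Y ** A))"
    using Y by (metis matrix_mul_assoc)
  also have "\<dots> = (Y ** A) ** (X ** A)"
    using X Y by (simp add: matrix_transpose_mul[of "X ** A" "Y ** A"])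
  also have "\<dots> = Y ** A" using X by (metis matrix_mul_assoc)
  finally have XYA: "X ** A = Y ** A" .
  have "X = X ** A ** X" using X by simp
  also have "\<dots> = Y ** A ** Y" using AXY XYA by (metis matrix_mul_assoc)
  finally show ?thesis using Y by simp
qed

lemma penrose_inverse_exists: "\<exists>X. is_penrose_inverse A X"
proof -
  define B where "B = transpose A"
  define V where "V = range ((*v) B)"
  have linB: "linear ((*v) (B ** A))" by (rule matrix_vector_mul_linear)
  have subV: "subspace V"
    unfolding V_def by (simp add: linear_subspace_image)
  have adj: "(B *v y) \<bullet> x = y \<bullet> (A *v x)" for x y
    by (simp add: B_def dot_lmul_matrix transpose_matrix_vector)
  have ker: "A *v x = 0" if "(B ** A) *v x = 0" for x
  proof -
    have "(A *v x) \<bullet> (A *v x) = (B *v (A *v x)) \<bullet> x" by (simp add: adj)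
    also have "\<dots> = 0" using that by (simp add: matrix_vector_mul_assoc)
    finally show ?thesis by simp
  qed
  have kerV: "x = 0" if "(B ** A) *v x = 0" "x \<in> V" for x
  proof -
    obtain y where y: "x = B *v y" using \<open>x \<in> V\<close> V_def by auto
    have "x \<bullet> x = y \<bullet> (A *v x)" using adj[of y x] y by simp
    with ker[OF that(1)] show ?thesis by simp
  qed
  have inj: "inj_on ((*v) (B ** A)) V"
    using linear_injective_on_subspace_0[OF linB subV] kerV by blast
  obtain g where g: "range g \<subseteq> V" "linear g"
      "\<And>v. v \<in> V \<Longrightarrow> g ((B ** A) *v v) = v"
    using linear_exists_left_inverse_on[OF linB subV inj] by blast
  have "(*v) (B ** A) ` V = V"
  proof (rule subspace_dim_equal)
    show "subspace ((*v) (B ** A) ` V)" by (rule linear_subspace_image[OF linB subV])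
    show "(*v) (B ** A) ` V \<subseteq> V" unfolding V_def by (auto simp flip: matrix_vector_mul_assoc)
    show "dim V \<le> dim ((*v) (B ** A) ` V)"
      using dim_image_eq[OF linB, of V] inj subV by (simp add: span_eq_iff[THEN iffD2])
  qed (rule subV)
  then have inv: "(B ** A) *v (g v) = v" if "v \<in> V" for v
    using that g(3) by (metis imageE)
  define X where "X = matrix g ** B"
  have X: "X *v y = g (B *v y)" for y
    by (simp add: X_def matrix_works linear_matrix_vector_mul_eq g(2) flip: matrix_vector_mul_assoc)
  have normal: "B *v (A *v (X *v y)) = B *v y" for y
    using inv[of "B *v y"] by (simp add: X V_def matrix_vector_mul_assoc)
  have AXA: "A *v (X *v (A *v x)) = A *v x" for x
  proof -
    have "(B ** A) *v (X *v (A *v x) - x) = 0"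
      using normal[of "A *v x"]
      by (simp add: matrix_vector_mult_diff_distrib flip: matrix_vector_mul_assoc)
    from ker[OF this] show ?thesis by (simp add: matrix_vector_mult_diff_distrib)
  qed
  have XAX: "X *v (A *v (X *v y)) = X *v y" for y
    using normal[of y] by (simp add: X)
  have ortho: "(A *v x) \<bullet> (A *v (X *v y)) = (A *v x) \<bullet> y" for x y
    using adj[of "A *v (X *v y)" x] adj[of y x] normal[of y] by (simp add: inner_commute)
  have sym1: "(A *v (X *v x)) \<bullet> y = x \<bullet> (A *v (X *v y))" for x y
    using ortho[of "X *v x" y] ortho[of "X *v y" x] by (simp add: inner_commute)
  have XV: "X *v y \<in> V" for y using g(1) X by auto
  have perp: "v \<bullet> (X *v (A *v y)) = v \<bullet> y" if "v \<in> V" for v y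
    using that AXA[of y] adj by (auto simp: V_def)
  have sym2: "(X *v (A *v x)) \<bullet> y = x \<bullet> (X *v (A *v y))" for x y
    using perp[OF XV, of "A *v x" y] perp[OF XV, of "A *v y" x] by (simp add: inner_commute)
  have tr: "transpose M = M" if "\<And>x y. (M *v x) \<bullet> y = x \<bullet> (M *v y)" for M :: "real^'k^'k"
  proof -
    have "(transpose M *v x) \<bullet> y = (M *v x) \<bullet> y" for x y
      using that by (simp add: dot_lmul_matrix transpose_matrix_vector)
    then show ?thesis by (metis matrix_eq vector_eq_rdot)
  qed
  have "is_penrose_inverse A X"
    unfolding is_penrose_inverse_def
  proof (intro conjI)
    show "A ** X ** A = A" by (simp add: matrix_eq AXA flip: matrix_vector_mul_assoc)
    show "X ** A ** X = X" by (simp add: matrix_eq XAX flip: matrix_vector_mul_assoc)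
    show "transpose (A ** X) = A ** X"
      by (rule tr) (simp add: sym1 flip: matrix_vector_mul_assoc)
    show "transpose (X ** A) = X ** A"
      by (rule tr) (simp add: sym2 flip: matrix_vector_mul_assoc)
  qed
  then show ?thesis ..
qed

lemma ex1_penrose_inverse: "\<exists>!X. is_penrose_inverse A X"
  using penrose_inverse_exists penrose_inverse_unique by blast

lemma pinv_is_penrose_inverse: "is_penrose_inverse A (pinv A)"
  unfolding pinv_def by (rule theI'[OF ex1_penrose_inverse])

end

theory Submission
  imports Defs
begin

text \<open>
  Write \<open>P\<close> for the projection, \<open>w\<^sub>i = \<parallel>P e\<^sub>i\<parallel>\<close> for the weights and \<open>u = \<Sum>\<^sub>j a\<^sub>j W\<^sup>-\<^sup>1 P e\<^sub>j\<close>.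

  Optimality is a subgradient argument, carried by \<open>dual_certificate_imp_minimizer\<close>: since
  \<open>P (y\<^sub>\<alpha> - x\<^sup>*) = - \<alpha> W u\<close>, the negative gradient of the quadratic term at \<open>y\<^sub>\<alpha>\<close> is \<open>\<alpha> W u\<close>, and the
  two conditions on the entries of \<open>u\<close>, together with the sign condition on \<open>\<alpha>\<close>, say that \<open>W u\<close> is
  a subgradient of \<open>\<parallel>W \<cdot>\<parallel>\<^sub>1\<close> at \<open>y\<^sub>\<alpha>\<close>. The objective is convex, so this suffices.

  The coefficients can be written down. For \<open>j \<in> J\<close> other than the exceptional index \<open>jt\<close>, the
  vector \<open>e\<^sub>j\<close> is fixed by \<open>P\<close>, so \<open>w\<^sub>j = 1\<close> and \<open>W\<^sup>-\<^sup>1 P e\<^sub>j = e\<^sub>j\<close>: these columns touch only their own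
  entry. As \<open>P\<close> is symmetric, the remaining column \<open>P e\<^sub>j\<^sub>t\<close> vanishes at all of those
  indices, so the entries of \<open>u\<close> on \<open>J\<close> decouple and \<open>a\<^sub>j = sgn x\<^sub>j\<^sup>* / w\<^sub>j\<close> works throughout.
  Off \<open>J\<close> only the exceptional column contributes, and its normalised entry is the cosine of the
  angle between \<open>P e\<^sub>i\<close> and \<open>P e\<^sub>j\<^sub>t\<close>. It lies strictly between \<open>-1\<close> and \<open>1\<close> because these vectors are not
  parallel, which is the hypothesis on the columns of \<open>A = A P\<close>.
\<close>

section \<open>The projection and the weights\<close>

lemma P_mat_symmetric: "(P_mat A *v x) \<bullet> y = x \<bullet> (P_mat A *v y)"
proof -
  have "transpose (P_mat A) = P_mat A"
    using pinv_is_penrose_inverse[of A] by (simp add: is_penrose_inverse_def P_mat_def)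
  then show ?thesis
    by (metis dot_lmul_matrix transpose_matrix_vector)
qed

lemma matrix_mult_P_mat: "A *v (P_mat A *v x) = A *v x"
  using pinv_is_penrose_inverse[of A]
  by (simp add: is_penrose_inverse_def P_mat_def matrix_vector_mul_assoc matrix_mul_assoc)

lemma P_mat_idem: "P_mat A *v (P_mat A *v x) = P_mat A *v x"
  using matrix_mult_P_mat[of A x] by (simp add: P_mat_def flip: matrix_vector_mul_assoc)

lemma P_mat_inner: "(P_mat A *v x) \<bullet> (P_mat A *v y) = (P_mat A *v x) \<bullet> y"
  by (metis P_mat_symmetric P_mat_idem)

text \<open>The residual \<open>x - P x\<close> lies in the null space, hence is orthogonal to \<open>x\<close>, and it is orthogonal
  to the range of \<open>P\<close>; so it is orthogonal to itself.\<close>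

lemma P_mat_fixes_orthogonal_comp:
  assumes "x \<in> (null_space A)\<^sup>\<bottom>"
  shows "P_mat A *v x = x"
proof -
  let ?r = "x - P_mat A *v x"
  have "?r \<in> null_space A"
    by (simp add: null_space_def matrix_vector_mult_diff_distrib matrix_mult_P_mat)
  then have "x \<bullet> ?r = 0"
    using assms by (auto simp: orthogonal_comp_def orthogonal_def inner_commute)
  moreover have "(P_mat A *v x) \<bullet> ?r = 0"
    by (simp add: inner_diff_right P_mat_inner)
  ultimately have "?r \<bullet> ?r = 0"
    by (simp only: inner_diff_left)
  then show ?thesis by simp
qed

text \<open>The entries of \<open>P\<close> are the Gram matrix of the projected basis vectors.\<close>

lemma P_mat_axis_nth:
  "(P_mat A *v axis j 1) $ i = (P_mat A *v axis j 1) \<bullet> (P_mat A *v axis i 1)"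
  by (simp add: P_mat_inner inner_axis)

lemma W_mat_nth: "(W_mat A *v x) $ i = norm (P_mat A *v axis i 1) * x $ i"
proof -
  have "(W_mat A *v x) $ i = (\<Sum>j\<in>UNIV. if i = j then norm (P_mat A *v axis i 1) * x $ j else 0)"
    unfolding matrix_vector_mult_def[of "W_mat A"] vec_lambda_beta
    by (rule sum.cong) (simp_all add: W_mat_def)
  then show ?thesis by simp
qed

lemma W_mat_invertible:
  assumes "\<And>i. P_mat A *v axis i 1 \<noteq> 0"
  shows "invertible (W_mat A)"
proof -
  have "x = 0" if "W_mat A *v x = 0" for x
  proof -
    have "norm (P_mat A *v axis i 1) * x $ i = 0" for i
      using that W_mat_nth[of A x i] by simp
    then have "x $ i = 0" for i
      using assms[of i] by (metis mult_eq_0_iff norm_eq_zero)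
    then show ?thesis by (simp add: vec_eq_iff)
  qed
  then show ?thesis
    using invertible_left_inverse matrix_left_invertible_ker by blast
qed

lemma W_mat_mult_inv:
  assumes "\<And>i. P_mat A *v axis i 1 \<noteq> 0"
  shows "W_mat A *v (matrix_inv (W_mat A) *v x) = x"
proof -
  have "W_mat A ** matrix_inv (W_mat A) = mat 1"
    using someI_ex[OF W_mat_invertible[OF assms, unfolded invertible_def]]
    by (simp add: matrix_inv_def)
  then show ?thesis
    by (simp add: matrix_vector_mul_assoc)
qed

lemma W_mat_inv_nth:
  assumes "\<And>i. P_mat A *v axis i 1 \<noteq> 0"
  shows "(matrix_inv (W_mat A) *v x) $ i = x $ i / norm (P_mat A *v axis i 1)"
proof -
  have "norm (P_mat A *v axis i 1) * (matrix_inv (W_mat A) *v x) $ i = x $ i"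
    using W_mat_mult_inv[OF assms, of x] by (metis W_mat_nth)
  then show ?thesis
    using assms[of i] by (simp add: field_simps)
qed

section \<open>A dual certificate implies optimality\<close>

text \<open>The hypotheses on \<open>u\<close> say that \<open>W u\<close> is a subgradient of \<open>\<parallel>W \<cdot>\<parallel>\<^sub>1\<close> at \<open>y\<close>, and
  \<open>stationary\<close> that \<open>\<alpha> W u\<close> cancels the gradient of the quadratic term there.\<close>

lemma dual_certificate_imp_minimizer:
  fixes A :: "real^'n^'m"
  assumes "\<alpha> \<ge> 0"
    and stationary: "P_mat A *v (y - z) = - \<alpha> *\<^sub>R (W_mat A *v u)"
    and bound: "\<And>i. \<bar>u $ i\<bar> \<le> 1"
    and tight: "\<And>i. u $ i * y $ i = \<bar>y $ i\<bar>"
  shows "1/2 * (norm (P_mat A *v y - P_mat A *v z))\<^sup>2 + \<alpha> * l1_norm (W_mat A *v y)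
       \<le> 1/2 * (norm (P_mat A *v x - P_mat A *v z))\<^sup>2 + \<alpha> * l1_norm (W_mat A *v x)"
proof -
  let ?w = "\<lambda>i. norm (P_mat A *v axis i 1)"
  let ?p = "P_mat A *v (y - z)" and ?q = "P_mat A *v (x - y)"
  have "u $ i * x $ i \<le> \<bar>x $ i\<bar>" for i
    by (metis abs_ge_self abs_ge_zero abs_mult bound mult_left_le_one_le order_trans)
  then have "?w i * (u $ i * (x $ i - y $ i)) \<le> ?w i * (\<bar>x $ i\<bar> - \<bar>y $ i\<bar>)" for i
    by (intro mult_left_mono) (auto simp: right_diff_distrib tight)
  then have "(\<Sum>i\<in>UNIV. ?w i * (u $ i * (x $ i - y $ i))) \<le> (\<Sum>i\<in>UNIV. ?w i * (\<bar>x $ i\<bar> - \<bar>y $ i\<bar>))"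
    by (rule sum_mono)
  then have subgradient: "(W_mat A *v u) \<bullet> (x - y) \<le> l1_norm (W_mat A *v x) - l1_norm (W_mat A *v y)"
    by (simp add: l1_norm_def inner_vec_def W_mat_nth abs_mult right_diff_distrib sum_subtractf mult.assoc)
  have "?p \<bullet> ?q = - \<alpha> * ((W_mat A *v u) \<bullet> (x - y))"
    unfolding P_mat_inner by (simp add: stationary)
  then have cross: "?p \<bullet> ?q \<ge> \<alpha> * l1_norm (W_mat A *v y) - \<alpha> * l1_norm (W_mat A *v x)"
    using mult_left_mono[OF subgradient \<open>\<alpha> \<ge> 0\<close>] by (simp add: right_diff_distrib)
  have "P_mat A *v x - P_mat A *v z = ?p + ?q"
    by (simp add: matrix_vector_mult_diff_distrib)
  then have "(norm (P_mat A *v x - P_mat A *v z))\<^sup>2 = (norm ?p)\<^sup>2 + 2 * (?p \<bullet> ?q) + (norm ?q)\<^sup>2"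
    by (simp add: power2_norm_eq_inner inner_add_left inner_add_right inner_commute)
  moreover have "(norm (P_mat A *v y - P_mat A *v z))\<^sup>2 = (norm ?p)\<^sup>2"
    by (simp add: matrix_vector_mult_diff_distrib)
  moreover have "(norm ?q)\<^sup>2 \<ge> 0"
    by simp
  ultimately show ?thesis
    using cross by linarith
qed

section \<open>Construction of the certificate\<close>

text \<open>Equality in the Cauchy--Schwarz inequality would make \<open>P e\<^sub>i\<close> a multiple of \<open>P e\<^sub>j\<close>; applying
  \<open>A = A P\<close> carries this over to the columns of \<open>A\<close>.\<close>

lemma P_mat_axis_strict_Cauchy_Schwarz:
  assumes nonzero: "P_mat A *v axis j 1 \<noteq> 0"
    and nonparallel: "\<And>\<eta>. A *v axis i 1 \<noteq> \<eta> *\<^sub>R (A *v axis j 1)"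
  shows "\<bar>(P_mat A *v axis j 1) \<bullet> (P_mat A *v axis i 1)\<bar>
    < norm (P_mat A *v axis j 1) * norm (P_mat A *v axis i 1)"
proof (rule ccontr)
  let ?p = "P_mat A *v axis j 1" and ?q = "P_mat A *v axis i 1"
  assume "\<not> ?thesis"
  then have "\<bar>?p \<bullet> ?q\<bar> = norm ?p * norm ?q"
    using Cauchy_Schwarz_ineq2[of ?p ?q] by linarith
  then have "collinear {0, ?p, ?q}"
    by (simp add: norm_cauchy_schwarz_equal)
  then obtain c where "?q = c *\<^sub>R ?p"
    using nonzero by (auto simp: collinear_lemma intro: that[of 0])
  then have "A *v ?q = c *\<^sub>R (A *v ?p)"
    by (simp add: matrix_vector_mult_scaleR)
  then show False
    using nonparallel[of c] by (simp add: matrix_mult_P_mat)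
qed

theorem corollary4p7p2:
  fixes A :: "real^'n^'m" and xs :: "real^'n" and J :: "'n set" and jt :: 'n
  assumes "null_space A \<noteq> {0}"
    and "\<And>i. P_mat A *v axis i 1 \<noteq> 0"
    and "J = supp xs"
    and "jt \<in> J"
    and "\<And>i j \<eta>. i \<noteq> j \<Longrightarrow> A *v axis i 1 \<noteq> \<eta> *\<^sub>R (A *v axis j 1)"
    and "\<And>j. j \<in> J - {jt} \<Longrightarrow> axis j 1 \<in> (null_space A)\<^sup>\<bottom>"
  shows "\<exists>a :: 'n \<Rightarrow> real.
      (\<forall>i\<in>J. (\<Sum>j\<in>J. a j *\<^sub>R (matrix_inv (W_mat A) *v (P_mat A *v axis j 1))) $ i = sgn (xs $ i)) \<and>
      (\<forall>i\<in>- J. (\<Sum>j\<in>J. a j *\<^sub>R (matrix_inv (W_mat A) *v (P_mat A *v axis j 1))) $ i \<in> {-1<..<1}) \<and>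
      (\<forall>\<alpha>>0. (\<forall>j\<in>J. sgn (xs $ j - \<alpha> * a j) = sgn (xs $ j)) \<longrightarrow>
        is_arg_min
          (\<lambda>x. 1/2 * (norm (P_mat A *v x - P_mat A *v xs))\<^sup>2 + \<alpha> * l1_norm (W_mat A *v x))
          (\<lambda>x. x \<in> UNIV)
          (\<Sum>j\<in>J. (xs $ j - \<alpha> * a j) *\<^sub>R axis j 1))"
proof -
  let ?p = "\<lambda>j. P_mat A *v axis j 1"
  let ?w = "\<lambda>j. norm (?p j)"
  define a where "a j = sgn (xs $ j) / ?w j" for j
  define u where "u = (\<Sum>j\<in>J. a j *\<^sub>R (matrix_inv (W_mat A) *v ?p j))"
  have w_pos: "?w j > 0" for j
    using assms(2) by simp
  have fixed: "?p j = axis j 1" if "j \<in> J - {jt}" for j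
    using assms(6)[OF that] by (rule P_mat_fixes_orthogonal_comp)
  have gram_zero: "?p j \<bullet> ?p i = 0" if "i \<noteq> j" "j \<in> J - {jt}" for i j
  proof -
    have "?p j \<bullet> ?p i = axis j 1 \<bullet> (axis i 1 :: real^'n)"
      by (metis P_mat_inner fixed that(2))
    with that show ?thesis by (simp add: inner_axis_axis)
  qed
  have u_nth: "u $ i = a k * (?p k \<bullet> ?p i) / ?w i"
    if "k \<in> J" and others: "\<And>j. j \<in> J - {k} \<Longrightarrow> ?p j \<bullet> ?p i = 0" for i k
  proof -
    have "u $ i = (\<Sum>j\<in>J. a j * (?p j \<bullet> ?p i) / ?w i)"
      by (simp add: u_def W_mat_inv_nth[OF assms(2)] P_mat_axis_nth[of A _ i])
    also have "\<dots> = (\<Sum>j\<in>{k}. a j * (?p j \<bullet> ?p i) / ?w i)"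
      by (rule sum.mono_neutral_right) (use that in auto)
    finally show ?thesis by simp
  qed

  have on_J: "u $ i = sgn (xs $ i)" if "i \<in> J" for i
  proof -
    have "?p j \<bullet> ?p i = 0" if "j \<in> J - {i}" for j
    proof -
      \<comment> \<open>At most one of the two indices is the exceptional one.\<close>
      have "j \<in> J - {jt} \<or> i \<in> J - {jt}" using that \<open>i \<in> J\<close> by auto
      then show ?thesis
        using gram_zero[of i j] gram_zero[of j i] that by (auto simp: inner_commute)
    qed
    then have "u $ i = a i * (?p i \<bullet> ?p i) / ?w i"
      by (rule u_nth[OF that])
    also have "\<dots> = sgn (xs $ i)"
      using w_pos[of i] by (simp add: a_def dot_square_norm power2_eq_square)
    finally show ?thesis .
  qed

  have off_J: "\<bar>u $ i\<bar> < 1" if "i \<notin> J" for i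
  proof -
    have "?p j \<bullet> ?p i = 0" if "j \<in> J - {jt}" for j
      using gram_zero[of i j] that \<open>i \<notin> J\<close> by force
    then have "u $ i = a jt * (?p jt \<bullet> ?p i) / ?w i"
      by (rule u_nth[OF assms(4)])
    moreover have "\<bar>sgn (xs $ jt)\<bar> = 1"
      using assms(3,4) by (simp add: supp_def abs_sgn_eq)
    ultimately have "\<bar>u $ i\<bar> = \<bar>?p jt \<bullet> ?p i\<bar> / (?w jt * ?w i)"
      by (simp add: a_def abs_mult)
    also have "\<dots> < 1"
    proof -
      have "i \<noteq> jt" using that assms(4) by auto
      then have "\<bar>?p jt \<bullet> ?p i\<bar> < ?w jt * ?w i"
        by (intro P_mat_axis_strict_Cauchy_Schwarz assms(2) assms(5))
      then show ?thesis using w_pos[of jt] w_pos[of i] by simp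
    qed
    finally show ?thesis .
  qed

  have minimizer: "is_arg_min
      (\<lambda>x. 1/2 * (norm (P_mat A *v x - P_mat A *v xs))\<^sup>2 + \<alpha> * l1_norm (W_mat A *v x))
      (\<lambda>x. x \<in> UNIV) (\<Sum>j\<in>J. (xs $ j - \<alpha> * a j) *\<^sub>R axis j 1)"
    if "\<alpha> > 0" and sgn: "\<forall>j\<in>J. sgn (xs $ j - \<alpha> * a j) = sgn (xs $ j)" for \<alpha>
  proof -
    define y :: "real^'n" where "y = (\<Sum>j\<in>J. (xs $ j - \<alpha> * a j) *\<^sub>R axis j 1)"
    have y_nth: "y $ i = (if i \<in> J then xs $ i - \<alpha> * a i else 0)" for i
    proof -
      have "y $ i = (\<Sum>j\<in>J. if i = j then xs $ j - \<alpha> * a j else 0)"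
        unfolding y_def sum_component by (rule sum.cong) (auto simp: axis_def)
      then show ?thesis by simp
    qed
    have bound: "\<bar>u $ i\<bar> \<le> 1" for i
    proof (cases "i \<in> J")
      case True
      then show ?thesis by (simp add: on_J abs_sgn_eq)
    qed (simp add: off_J less_imp_le)
    have tight: "u $ i * y $ i = \<bar>y $ i\<bar>" for i
    proof (cases "i \<in> J")
      case True
      then have "u $ i = sgn (y $ i)" using sgn by (simp add: on_J y_nth)
      then show ?thesis by (simp add: abs_sgn mult.commute)
    qed (simp add: y_nth)
    have "y - xs = - \<alpha> *\<^sub>R (\<Sum>j\<in>J. a j *\<^sub>R axis j 1)"
    proof -
      have "xs $ i = 0" if "i \<notin> J" for i
        using that assms(3) by (simp add: supp_def)
      moreover have "(\<Sum>j\<in>J. a j *\<^sub>R axis j 1 :: real^'n) $ i = (if i \<in> J then a i else 0)" for i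
      proof -
        have "(\<Sum>j\<in>J. a j *\<^sub>R axis j 1 :: real^'n) $ i = (\<Sum>j\<in>J. if i = j then a j else 0)"
          unfolding sum_component by (rule sum.cong) (auto simp: axis_def)
        then show ?thesis by simp
      qed
      ultimately show ?thesis by (auto simp: vec_eq_iff y_nth simp del: sum_component)
    qed
    then have "P_mat A *v (y - xs) = - \<alpha> *\<^sub>R (\<Sum>j\<in>J. a j *\<^sub>R ?p j)"
      by (simp only: matrix_vector_mult_scaleR linear_sum[OF matrix_vector_mul_linear] o_def)
    also have "(\<Sum>j\<in>J. a j *\<^sub>R ?p j) = W_mat A *v u"
      unfolding u_def
      by (simp add: linear_sum[OF matrix_vector_mul_linear] matrix_vector_mult_scaleR
          W_mat_mult_inv[OF assms(2)])
    finally have stationary: "P_mat A *v (y - xs) = - \<alpha> *\<^sub>R (W_mat A *v u)" .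
    show ?thesis
      unfolding is_arg_min_def y_def[symmetric]
      using dual_certificate_imp_minimizer[OF less_imp_le[OF \<open>\<alpha> > 0\<close>] stationary bound tight]
      by (auto simp: not_less)
  qed

  show ?thesis
  proof (intro exI[of _ a] conjI allI impI)
    show "\<forall>i\<in>J. (\<Sum>j\<in>J. a j *\<^sub>R (matrix_inv (W_mat A) *v ?p j)) $ i = sgn (xs $ i)"
      using on_J unfolding u_def by blast
    show "\<forall>i\<in>- J. (\<Sum>j\<in>J. a j *\<^sub>R (matrix_inv (W_mat A) *v ?p j)) $ i \<in> {-1<..<1}"
      using off_J unfolding u_def[symmetric] by (auto simp: abs_less_iff minus_less_iff)
  qed (rule minimizer)
qed

end
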